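(* Let $\mathbf e\in\mathbb R^3$ be a unit vector, $\theta\in\mathbb R$, $\tau\in\mathbb R\setminus\{0\}$, $i\ge1$ an integer, $\alpha=2\pi/i$, and $\mathbf z,\mathbf p\in\mathbb R^3$ with $r=|\mathbf p-\mathbf z|>0$ and $(\mathbf p-\mathbf z)\cdot\mathbf e=0$. Let $$g(n,m)=\big(\mathbf Q_{m\theta+n\alpha}\,\big|\,m\tau\mathbf e+(\mathbf I-\mathbf Q_{m\theta+n\alpha})\mathbf z\big),\qquad G=\{g(n,m): m\in\mathbb Z,\ n=-i,\dots,0,\dots,i\}.$$ Let $(n_1,m_1)$, $(n_2,m_2)$ be the pairs of integers defining nearest neighbor generators $g_1=g(n_1,m_1)$, $g_2=g(n_2,m_2)$ of $G$ (see context), with $-\pi/2\le m_j\theta+n_j\alpha\le\pi/2$ for $j=1,2$, labeled so that $m_1\ne0$. Let $$\hat q(n)=\frac{-n\,i\,m_1}{n_1m_2-n_2m_1},\qquad q^\star=\min\{\hat q(n): n\in\mathbb Z\setminus\{0\},\ \hat q(n)>0,\ \hat q(n)\in\mathbb Z\}.$$ Then for every $q_0\in\mathbb Z$ the set $\mathcal D_{q_0}=\mathbb Z\times\{q_0+1,\dots,q_0+q^\star\}$ satisfies $$G=\{g_1^pg_2^q:(p,q)\in\mathcal D_{q_0}\},$$ and this description has no repeated elements: distinct pairs $(p,q)\in\mathcal D_{q_0}$ give distinct elements $g_1^pg_2^q$.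
   Context: $(\mathbf Q|\mathbf c)$ denotes the isometry $\mathbf x\mapsto\mathbf Q\mathbf x+\mathbf c$ of $\mathbb R^3$, the group product being composition. $\mathbf Q_\xi$ denotes the rotation of $\mathbb R^3$ with axis $\mathbf e$ and (right-handed) angle $\xi$. Nearest neighbor generators: let $h$ be the smallest integer greater than $2r^2/\tau^2-1/2$ and let $A$ be the set of integer pairs $(n,m)$ with $-i\le n\le i$, $|m|\le h$ and $g(n,m)\ne\mathrm{id}$. Let $(k_1,l_1)$ be a minimizer over $A$ of $4r^2\sin^2\big(\frac{m\theta+n\alpha}{2}\big)+m^2\tau^2$ and let $(k_2,l_2)$ be a minimizer of the same function over the pairs $(n,m)\in A$ with $l_1n\ne m\,k_1$. The pairs $(n_1,m_1),(n_2,m_2)$ are $(k_1,l_1),(k_2,l_2)$, with the order exchanged if necessary so that $m_1\neq0$ (this is possible since $n_1m_2-n_2m_1\neq0$). *)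

theory Defs
  imports "HOL-Analysis.Cross3" "HOL-Algebra.Group"
begin

definition affine_isom :: "real^3^3 \<Rightarrow> real^3 \<Rightarrow> real^3 \<Rightarrow> real^3" where
  "affine_isom Q c = (\<lambda>x. Q *v x + c)"

definition isometry_group :: "(real^3 \<Rightarrow> real^3) monoid" where
  "isometry_group =
     \<lparr>carrier = {affine_isom Q c | Q c. orthogonal_matrix Q}, monoid.mult = (\<circ>), one = id\<rparr>"

text \<open>Rodrigues' formula: for a unit vector \<open>e\<close>, the right-handed rotation about \<open>e\<close> by \<open>\<xi>\<close>.\<close>

definition rot :: "real^3 \<Rightarrow> real \<Rightarrow> real^3^3" where
  "rot e \<xi> = matrix (\<lambda>x. cos \<xi> *\<^sub>R x + sin \<xi> *\<^sub>R cross3 e x + ((1 - cos \<xi>) * (e \<bullet> x)) *\<^sub>R e)"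

definition helix_elem ::
  "real^3 \<Rightarrow> real \<Rightarrow> real \<Rightarrow> real \<Rightarrow> real^3 \<Rightarrow> int \<Rightarrow> int \<Rightarrow> real^3 \<Rightarrow> real^3" where
  "helix_elem e \<theta> \<tau> \<alpha> z n m =
     (let Q = rot e (of_int m * \<theta> + of_int n * \<alpha>)
      in affine_isom Q ((of_int m * \<tau>) *\<^sub>R e + (mat 1 - Q) *v z))"

definition helix_group ::
  "real^3 \<Rightarrow> real \<Rightarrow> real \<Rightarrow> int \<Rightarrow> real \<Rightarrow> real^3 \<Rightarrow> (real^3 \<Rightarrow> real^3) set" where
  "helix_group e \<theta> \<tau> i \<alpha> z = {helix_elem e \<theta> \<tau> \<alpha> z n m | n m. n \<in> {-i..i}}"

definition nn_bound :: "real \<Rightarrow> real \<Rightarrow> int" where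
  "nn_bound r \<tau> = (LEAST h::int. of_int h > 2 * r\<^sup>2 / \<tau>\<^sup>2 - 1 / 2)"

definition nn_candidates ::
  "real^3 \<Rightarrow> real \<Rightarrow> real \<Rightarrow> int \<Rightarrow> real \<Rightarrow> real^3 \<Rightarrow> real \<Rightarrow> (int \<times> int) set" where
  "nn_candidates e \<theta> \<tau> i \<alpha> z r =
     {(n, m). - i \<le> n \<and> n \<le> i \<and> \<bar>m\<bar> \<le> nn_bound r \<tau> \<and> helix_elem e \<theta> \<tau> \<alpha> z n m \<noteq> id}"

text \<open>The squared distance \<open>\<bar>g(n,m) p - p\<bar>\<^sup>2\<close> for a point \<open>p\<close> at distance \<open>r\<close> from the axis.\<close>

definition nn_dist2 :: "real \<Rightarrow> real \<Rightarrow> real \<Rightarrow> real \<Rightarrow> int \<times> int \<Rightarrow> real" where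
  "nn_dist2 r \<theta> \<tau> \<alpha> = (\<lambda>(n, m).
     4 * r\<^sup>2 * (sin ((of_int m * \<theta> + of_int n * \<alpha>) / 2))\<^sup>2 + (of_int m)\<^sup>2 * \<tau>\<^sup>2)"

text \<open>Minimizers need not be unique; any choice is admitted, as is either order of the two
  pairs for which the first one has a nonzero second component.\<close>

definition nearest_neighbor_pairs ::
  "real^3 \<Rightarrow> real \<Rightarrow> real \<Rightarrow> int \<Rightarrow> real \<Rightarrow> real^3 \<Rightarrow> real \<Rightarrow> int \<times> int \<Rightarrow> int \<times> int \<Rightarrow> bool" where
  "nearest_neighbor_pairs e \<theta> \<tau> i \<alpha> z r v w \<longleftrightarrow>
     (\<exists>k1 l1 k2 l2.
        is_arg_min (nn_dist2 r \<theta> \<tau> \<alpha>) (\<lambda>(n, m). (n, m) \<in> nn_candidates e \<theta> \<tau> i \<alpha> z r) (k1, l1) \<and>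
        is_arg_min (nn_dist2 r \<theta> \<tau> \<alpha>)
          (\<lambda>(n, m). (n, m) \<in> nn_candidates e \<theta> \<tau> i \<alpha> z r \<and> l1 * n \<noteq> m * k1) (k2, l2) \<and>
        (v = (k1, l1) \<and> w = (k2, l2) \<or> v = (k2, l2) \<and> w = (k1, l1)) \<and>
        snd v \<noteq> 0)"

definition qhat :: "int \<Rightarrow> int \<times> int \<Rightarrow> int \<times> int \<Rightarrow> int \<Rightarrow> real" where
  "qhat i = (\<lambda>(n1, m1) (n2, m2) n.
     of_int (- n * i * m1) / of_int (n1 * m2 - n2 * m1))"

definition qstar :: "int \<Rightarrow> int \<times> int \<Rightarrow> int \<times> int \<Rightarrow> int" where
  "qstar i v w =
     (LEAST q::int. of_int q \<in> {qhat i v w n | n. n \<noteq> 0 \<and> qhat i v w n > 0 \<and> qhat i v w n \<in> \<int>})"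

lemma affine_isom_comp:
  "affine_isom Q c \<circ> affine_isom R d = affine_isom (Q ** R) (Q *v d + c)"
  by (auto simp: affine_isom_def fun_eq_iff matrix_vector_mul_assoc matrix_vector_right_distrib)

lemma affine_isom_id: "affine_isom (mat 1) 0 = id"
  by (auto simp: affine_isom_def)

lemma group_isometry_group: "group isometry_group"
proof (rule groupI)
  fix f g assume "f \<in> carrier isometry_group" "g \<in> carrier isometry_group"
  then show "f \<otimes>\<^bsub>isometry_group\<^esub> g \<in> carrier isometry_group"
    by (auto simp: isometry_group_def affine_isom_comp) (metis orthogonal_matrix_mul)
next
  show "\<one>\<^bsub>isometry_group\<^esub> \<in> carrier isometry_group"
    using affine_isom_id[symmetric] orthogonal_matrix_id unfolding isometry_group_def by fastforce
next
  fix f assume "f \<in> carrier isometry_group"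
  then obtain Q c where f: "f = affine_isom Q c" "orthogonal_matrix Q"
    by (auto simp: isometry_group_def)
  have "affine_isom (transpose Q) (- (transpose Q *v c)) \<circ> f = id"
    using f by (simp add: affine_isom_comp orthogonal_matrix affine_isom_id)
  moreover have "affine_isom (transpose Q) (- (transpose Q *v c)) \<in> carrier isometry_group"
    using f by (auto simp: isometry_group_def)
  ultimately show "\<exists>g\<in>carrier isometry_group. g \<otimes>\<^bsub>isometry_group\<^esub> f = \<one>\<^bsub>isometry_group\<^esub>"
    by (auto simp: isometry_group_def)
qed (auto simp: isometry_group_def)

lemma orthogonal_matrix_rot:
  assumes "norm e = 1"
  shows "orthogonal_matrix (rot e \<xi>)"
proof -
  let ?f = "\<lambda>x. cos \<xi> *\<^sub>R x + sin \<xi> *\<^sub>R cross3 e x + ((1 - cos \<xi>) * (e \<bullet> x)) *\<^sub>R e"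
  have lin: "linear ?f"
    by (rule linearI)
      (simp_all add: cross_add_right cross_mult_right algebra_simps inner_add_right scaleR_add_right)
  have ee: "e \<bullet> e = 1" using assms by (simp add: norm_eq_1)
  have "norm (?f x) = norm x" for x
  proof -
    have xx: "cross3 e x \<bullet> cross3 e x = x \<bullet> x - (e \<bullet> x)\<^sup>2"
      using norm_cross_dot[of e x] assms by (simp add: power2_norm_eq_inner[symmetric] power_mult_distrib)
    have *: "cross3 e x \<bullet> e = 0" "cross3 e x \<bullet> x = 0" "e \<bullet> cross3 e x = 0" "x \<bullet> cross3 e x = 0"
      by (simp_all add: dot_cross_self)
    have "?f x \<bullet> ?f x = (cos \<xi>)\<^sup>2 * (x \<bullet> x) + (sin \<xi>)\<^sup>2 * (x \<bullet> x - (e \<bullet> x)\<^sup>2)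
            + 2 * cos \<xi> * (1 - cos \<xi>) * (e \<bullet> x)\<^sup>2 + (1 - cos \<xi>)\<^sup>2 * (e \<bullet> x)\<^sup>2"
      by (simp add: inner_add_left inner_add_right * xx ee inner_commute[of x e] power2_eq_square algebra_simps)
    also have "\<dots> = x \<bullet> x"
      using sin_cos_squared_add[of \<xi>] by algebra
    finally show ?thesis by (simp add: norm_eq)
  qed
  then have "orthogonal_transformation ?f"
    using lin by (simp add: orthogonal_transformation)
  then show ?thesis
    by (simp add: rot_def orthogonal_transformation_matrix)
qed

lemma helix_elem_in_isometry_group:
  "norm e = 1 \<Longrightarrow> helix_elem e \<theta> \<tau> \<alpha> z n m \<in> carrier isometry_group"
  using orthogonal_matrix_rot by (auto simp: helix_elem_def isometry_group_def Let_def)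

end

(* The map (n, m) -> g(n, m) is a homomorphism on Z^2 with kernel i Z x {0}, so everything reduces to
   showing that the two pairs form a basis of Z^2. The squared displacement
   2 r^2 (1 - cos x) + tau^2 m^2, with x = m theta + n alpha, is strictly convex on the strip
   |x| <= pi/2. Reduce an arbitrary integer pair modulo the two pairs to a combination with
   coefficients in [-1/2, 1/2]: it stays in the strip and among the candidates, but by convexity its
   displacement is below the minimum it competes with, so it must vanish. With determinant +-1 one
   gets q* = i |m_1|, the order of g_2 modulo the subgroup generated by g_1. *)

theory Submission
  imports Defs
begin

section \<open>Screw motions about a fixed axis as a homomorphic image of the integer plane\<close>

lemma rot_apply:
  "rot e \<xi> *v x = cos \<xi> *\<^sub>R x + sin \<xi> *\<^sub>R cross3 e x + ((1 - cos \<xi>) * (e \<bullet> x)) *\<^sub>R e"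
proof -
  have "linear (\<lambda>x. cos \<xi> *\<^sub>R x + sin \<xi> *\<^sub>R cross3 e x + ((1 - cos \<xi>) * (e \<bullet> x)) *\<^sub>R e)"
    by (rule linearI)
      (simp_all add: cross_add_right cross_mult_right algebra_simps inner_add_right scaleR_add_right)
  then show ?thesis
    by (simp add: rot_def)
qed

lemma rot_axis: "norm e = 1 \<Longrightarrow> rot e \<xi> *v e = e"
  by (simp add: rot_apply norm_eq_1 algebra_simps)

text \<open>Lagrange's identity turns the double cross product into
  \<open>(e \<bullet> x) *\<^sub>R e - x\<close>; what remains are the addition formulas for cosine
  and sine.\<close>

lemma rot_rot:
  assumes "norm e = 1"
  shows "rot e \<xi> *v (rot e \<eta> *v x) = rot e (\<xi> + \<eta>) *v x"
proof -
  have ee: "e \<bullet> e = 1" using assms by (simp add: norm_eq_1)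
  have cc: "cross3 e (cross3 e x) = (e \<bullet> x) *\<^sub>R e - x"
    using Lagrange[of e e x] ee by simp
  show ?thesis
    by (simp add: cc rot_apply cross_add_right cross_mult_right inner_add_right ee dot_cross_self
        cos_add sin_add algebra_simps)
qed

text \<open>Centring at \<open>z\<close> shows a screw motion about the line through
  \<open>z\<close> along \<open>e\<close>; in this form composition just adds angles and
  translations.\<close>

lemma helix_elem_apply:
  assumes "norm e = 1"
  shows "helix_elem e \<theta> \<tau> \<alpha> z n m x =
    z + rot e (of_int m * \<theta> + of_int n * \<alpha>) *v (x - z) + (of_int m * \<tau>) *\<^sub>R e"
  by (simp add: helix_elem_def affine_isom_def Let_def matrix_vector_mult_diff_distrib
      matrix_vector_mult_diff_rdistrib)

lemma helix_elem_add:
  assumes "norm e = 1"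
  shows "helix_elem e \<theta> \<tau> \<alpha> z (n + n') (m + m') =
    helix_elem e \<theta> \<tau> \<alpha> z n m \<circ> helix_elem e \<theta> \<tau> \<alpha> z n' m'"
proof
  fix x
  let ?\<xi> = "of_int m * \<theta> + of_int n * \<alpha>" and ?\<eta> = "of_int m' * \<theta> + of_int n' * \<alpha>"
  have angle: "of_int (m + m') * \<theta> + of_int (n + n') * \<alpha> = ?\<xi> + ?\<eta>"
    by (simp add: algebra_simps)
  show "helix_elem e \<theta> \<tau> \<alpha> z (n + n') (m + m') x =
      (helix_elem e \<theta> \<tau> \<alpha> z n m \<circ> helix_elem e \<theta> \<tau> \<alpha> z n' m') x"
    by (simp only: helix_elem_apply[OF assms] o_apply angle)
      (simp add: matrix_vector_right_distrib matrix_vector_mult_scaleR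
        rot_rot[OF assms] rot_axis[OF assms] algebra_simps)
qed

text \<open>Two test points suffice. The point \<open>z\<close> lies on the axis and is moved by the
  translation alone, which forces \<open>m = 0\<close>; the point \<open>p\<close> lies off the
  axis, and pairing its image with \<open>p - z\<close> isolates the cosine, which must be
  1.\<close>

lemma helix_elem_eq_id_iff:
  fixes e z p :: "real^3"
  assumes "norm e = 1" "\<tau> \<noteq> 0" "i \<ge> 1" "\<alpha> = 2 * pi / of_int i"
    and "p \<noteq> z" "(p - z) \<bullet> e = 0"
  shows "helix_elem e \<theta> \<tau> \<alpha> z n m = id \<longleftrightarrow> m = 0 \<and> i dvd n"
proof
  assume id: "helix_elem e \<theta> \<tau> \<alpha> z n m = id"
  have "helix_elem e \<theta> \<tau> \<alpha> z n m z = z" by (simp add: id)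
  then have m: "m = 0"
    using assms by (auto simp: helix_elem_apply)
  let ?\<xi> = "of_int n * \<alpha>"
  have "helix_elem e \<theta> \<tau> \<alpha> z n m p = p" by (simp add: id)
  then have "rot e ?\<xi> *v (p - z) = p - z"
    by (simp add: helix_elem_apply[OF assms(1)] m algebra_simps)
  then have "(rot e ?\<xi> *v (p - z)) \<bullet> (p - z) = (p - z) \<bullet> (p - z)"
    by simp
  then have "cos ?\<xi> * ((p - z) \<bullet> (p - z)) = (p - z) \<bullet> (p - z)"
    using assms(6) by (simp add: rot_apply inner_add_left dot_cross_self inner_commute[of e])
  then have "cos ?\<xi> = 1"
    using assms(5) by simp
  then obtain k :: int where "?\<xi> = of_int k * 2 * pi"
    by (auto simp: cos_one_2pi_int)
  then have "real_of_int n = of_int k * of_int i"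
    using assms(3,4) by (simp add: field_simps)
  then have "n = k * i"
    by (metis of_int_eq_iff of_int_mult)
  with m show "m = 0 \<and> i dvd n" by simp
next
  assume *: "m = 0 \<and> i dvd n"
  then obtain k where "n = i * k" by blast
  then have \<xi>: "of_int n * \<alpha> = 2 * pi * of_int k"
    using assms(3,4) by simp
  show "helix_elem e \<theta> \<tau> \<alpha> z n m = id"
    using * by (auto simp: helix_elem_apply[OF assms(1)] \<xi> rot_apply)
qed

lemma helix_elem_0: "norm e = 1 \<Longrightarrow> helix_elem e \<theta> \<tau> \<alpha> z 0 0 = id"
  by (auto simp: helix_elem_apply rot_apply)

lemma helix_elem_int_pow:
  assumes "norm e = 1"
  shows "helix_elem e \<theta> \<tau> \<alpha> z n m [^]\<^bsub>isometry_group\<^esub> (s::int) =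
    helix_elem e \<theta> \<tau> \<alpha> z (s * n) (s * m)"
proof -
  interpret group isometry_group by (rule group_isometry_group)
  let ?g = "helix_elem e \<theta> \<tau> \<alpha> z"
  note carrier = helix_elem_in_isometry_group[OF assms]
  have mult: "?g a b \<otimes>\<^bsub>isometry_group\<^esub> ?g c d = ?g (a + c) (b + d)" for a b c d
    by (simp add: isometry_group_def helix_elem_add[OF assms])
  have one: "\<one>\<^bsub>isometry_group\<^esub> = ?g 0 0"
    by (simp add: isometry_group_def helix_elem_0[OF assms])
  have nat: "?g n m [^]\<^bsub>isometry_group\<^esub> k = ?g (int k * n) (int k * m)" for k :: nat
    by (induction k) (simp_all add: one mult algebra_simps)
  have inv: "inv\<^bsub>isometry_group\<^esub> ?g a b = ?g (- a) (- b)" for a b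
    by (rule inv_equality) (simp_all add: mult one carrier)
  show ?thesis
    by (cases s rule: int_cases2) (simp_all add: int_pow_int int_pow_neg_int nat inv carrier)
qed

section \<open>Convexity of the squared displacement\<close>

text \<open>The second derivative is the cosine, nonnegative on this strip; this is why the angles
  of the generators are confined to it.\<close>

lemma convex_on_one_minus_cos: "convex_on {- (pi / 2)..pi / 2} (\<lambda>x. 1 - cos x)"
proof (rule f''_ge0_imp_convex)
  show "((\<lambda>x. 1 - cos x) has_real_derivative sin x) (at x)" for x :: real
    by (auto intro!: derivative_eq_intros)
  show "(sin has_real_derivative cos x) (at x)" for x :: real
    by (auto intro!: derivative_eq_intros)
  show "cos x \<ge> 0" if "x \<in> {- (pi / 2)..pi / 2}" for x
    using that by (auto intro: cos_ge_zero)
qed simp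

text \<open>Evenness absorbs the signs of \<open>a\<close> and \<open>b\<close> into the points, and
  the missing weight is put on 0, where \<open>f\<close> vanishes.\<close>

lemma convex_on_even_combination:
  fixes f :: "real \<Rightarrow> real"
  assumes f: "convex_on {-c..c} f" "f 0 = 0" and even: "\<And>x. f (- x) = f x"
    and "\<bar>x\<bar> \<le> c" "\<bar>y\<bar> \<le> c" "\<bar>a\<bar> + \<bar>b\<bar> \<le> 1"
  shows "f (a * x + b * y) \<le> \<bar>a\<bar> * f x + \<bar>b\<bar> * f y"
proof -
  define u where "u = sgn a * x"
  define v where "v = sgn b * y"
  have uv: "u \<in> {-c..c}" "v \<in> {-c..c}"
    using assms by (auto simp: u_def v_def sgn_if)
  have au: "a * x = \<bar>a\<bar> * u" and bv: "b * y = \<bar>b\<bar> * v"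
    by (auto simp: u_def v_def sgn_if)
  have fu: "\<bar>a\<bar> * f u = \<bar>a\<bar> * f x" and fv: "\<bar>b\<bar> * f v = \<bar>b\<bar> * f y"
    by (auto simp: u_def v_def sgn_if even)
  \<comment> \<open>Jensen's inequality for the three points \<open>u\<close>, \<open>v\<close> and
    0.\<close>
  let ?w = "\<lambda>k::nat. if k = 0 then \<bar>a\<bar> else if k = 1 then \<bar>b\<bar> else 1 - \<bar>a\<bar> - \<bar>b\<bar>"
  let ?p = "\<lambda>k::nat. if k = 0 then u else if k = 1 then v else 0"
  have S: "{..<3} = {0, 1, 2::nat}" by auto
  have "f (\<Sum>k\<in>{..<3}. ?w k *\<^sub>R ?p k) \<le> (\<Sum>k\<in>{..<3}. ?w k * f (?p k))"
    by (rule convex_on_sum[OF _ _ f(1)]) (use uv assms in \<open>auto simp: S\<close>)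
  then show ?thesis
    by (simp add: S au bv fu fv f(2))
qed

text \<open>Strict convexity at midpoints: the gap is
  \<open>cos ((x + y) / 2) * (1 - cos ((x - y) / 2))\<close>.\<close>

lemma one_minus_cos_midpoint_less:
  assumes "\<bar>x\<bar> \<le> pi / 2" "\<bar>y\<bar> \<le> pi / 2" "x \<noteq> y"
  shows "1 - cos ((x + y) / 2) < ((1 - cos x) + (1 - cos y)) / 2"
proof -
  have "cos ((x + y) / 2) > 0"
    by (rule cos_gt_zero_pi) (use assms in \<open>auto simp: abs_if split: if_splits\<close>)
  moreover have "cos ((x - y) / 2) < 1"
  proof -
    have "\<bar>x - y\<bar> \<le> pi"
      using assms by linarith
    then have "\<bar>x - y\<bar> \<le> pi * 2"
      using pi_gt_zero by linarith
    then have "cos (\<bar>x - y\<bar> / 2) < cos 0"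
      using assms(3) by (intro cos_monotone_0_pi) auto
    moreover have "\<bar>x - y\<bar> / 2 = \<bar>(x - y) / 2\<bar>" by simp
    ultimately show ?thesis by (simp only: cos_abs_real cos_zero)
  qed
  ultimately have "cos ((x + y) / 2) * cos ((x - y) / 2) < cos ((x + y) / 2)"
    by simp
  moreover have "cos x + cos y = 2 * (cos ((x + y) / 2) * cos ((x - y) / 2))"
    by (simp add: cos_plus_cos)
  ultimately show ?thesis by simp
qed

text \<open>The squared displacement with angle \<open>x\<close> and height index \<open>t\<close>
  as independent real variables, so that convexity applies to non-integer combinations; the case of
  interest is \<open>c = 2 * r\<^sup>2\<close>, \<open>d = \<tau>\<^sup>2\<close>.\<close>

definition chord_energy :: "real \<Rightarrow> real \<Rightarrow> real \<Rightarrow> real \<Rightarrow> real" where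
  "chord_energy c d x t = c * (1 - cos x) + d * t\<^sup>2"

lemma nn_dist2_eq_chord_energy:
  "nn_dist2 r \<theta> \<tau> \<alpha> (n, m) =
    chord_energy (2 * r\<^sup>2) (\<tau>\<^sup>2) (of_int m * \<theta> + of_int n * \<alpha>) (of_int m)"
proof -
  have "1 - cos x = 2 * (sin (x / 2))\<^sup>2" for x :: real
    using cos_double_sin[of "x / 2"] by simp
  then show ?thesis
    by (simp add: nn_dist2_def chord_energy_def)
qed

lemma chord_energy_minus [simp]: "chord_energy c d (- x) (- t) = chord_energy c d x t"
  by (simp add: chord_energy_def)

lemma chord_energy_pos:
  assumes "c > 0" "d > 0" "\<bar>x\<bar> \<le> pi / 2" "x \<noteq> 0 \<or> t \<noteq> 0"
  shows "chord_energy c d x t > 0"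
proof (cases "t = 0")
  case True
  then have "cos \<bar>x\<bar> < cos 0"
    using assms pi_gt_zero by (intro cos_monotone_0_pi) linarith+
  then show ?thesis
    using assms True by (simp add: chord_energy_def)
next
  case False
  then have "d * t\<^sup>2 > 0" using assms by simp
  moreover have "c * (1 - cos x) \<ge> 0" using assms by simp
  ultimately show ?thesis by (simp add: chord_energy_def)
qed

lemma chord_energy_combination_le:
  assumes "c > 0" "d > 0" "\<bar>x\<bar> \<le> pi / 2" "\<bar>y\<bar> \<le> pi / 2" "\<bar>a\<bar> + \<bar>b\<bar> \<le> 1"
  shows "chord_energy c d (a * x + b * y) (a * s + b * t) \<le>
    \<bar>a\<bar> * chord_energy c d x s + \<bar>b\<bar> * chord_energy c d y t"
proof -
  have "1 - cos (a * x + b * y) \<le> \<bar>a\<bar> * (1 - cos x) + \<bar>b\<bar> * (1 - cos y)"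
    by (rule convex_on_even_combination[where c = "pi / 2"])
      (use assms convex_on_one_minus_cos in auto)
  then have *: "c * (1 - cos (a * x + b * y)) \<le> c * (\<bar>a\<bar> * (1 - cos x) + \<bar>b\<bar> * (1 - cos y))"
    using assms(1) by (intro mult_left_mono) auto
  have "convex_on {- max \<bar>s\<bar> \<bar>t\<bar>..max \<bar>s\<bar> \<bar>t\<bar>} (\<lambda>x::real. x\<^sup>2)"
    by (rule convex_on_subset[OF convex_power2]) auto
  then have "(a * s + b * t)\<^sup>2 \<le> \<bar>a\<bar> * s\<^sup>2 + \<bar>b\<bar> * t\<^sup>2"
    by (rule convex_on_even_combination) (use assms in auto)
  then have "d * (a * s + b * t)\<^sup>2 \<le> d * (\<bar>a\<bar> * s\<^sup>2 + \<bar>b\<bar> * t\<^sup>2)"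
    using assms(2) by (intro mult_left_mono) auto
  with * show ?thesis
    by (simp add: chord_energy_def algebra_simps)
qed

text \<open>For equal angles strictness comes from the square, otherwise from the cosine
  term.\<close>

lemma chord_energy_midpoint_less:
  assumes "c > 0" "d > 0" "\<bar>x\<bar> \<le> pi / 2" "\<bar>y\<bar> \<le> pi / 2" "(x, s) \<noteq> (y, t)"
  shows "chord_energy c d ((x + y) / 2) ((s + t) / 2) <
    (chord_energy c d x s + chord_energy c d y t) / 2"
proof (cases "x = y")
  case True
  have "(s - t)\<^sup>2 > 0" using True assms(5) by simp
  then have "((s + t) / 2)\<^sup>2 < (s\<^sup>2 + t\<^sup>2) / 2"
    by (simp add: power2_eq_square field_simps)
  then have "d * ((s + t) / 2)\<^sup>2 < d * ((s\<^sup>2 + t\<^sup>2) / 2)"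
    using assms(2) by (intro mult_strict_left_mono)
  then show ?thesis
    by (simp add: chord_energy_def True field_simps)
next
  case False
  have "c * (1 - cos ((x + y) / 2)) < c * (((1 - cos x) + (1 - cos y)) / 2)"
    using assms(1) one_minus_cos_midpoint_less[OF assms(3,4) False]
    by (intro mult_strict_left_mono)
  moreover have "d * ((s + t) / 2)\<^sup>2 \<le> d * ((s\<^sup>2 + t\<^sup>2) / 2)"
  proof (rule mult_left_mono)
    have "(s - t)\<^sup>2 \<ge> 0" by simp
    then show "((s + t) / 2)\<^sup>2 \<le> (s\<^sup>2 + t\<^sup>2) / 2"
      by (simp add: power2_eq_square field_simps)
  qed (use assms in simp)
  ultimately show ?thesis
    by (simp add: chord_energy_def field_simps)
qed

text \<open>Plain convexity yields the factor \<open>\<bar>a\<bar> + \<bar>b\<bar>\<close>, which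
  suffices when it is below 1. Otherwise both coefficients are 1/2 in absolute value, and the
  combination is up to sign the midpoint of \<open>(x, s)\<close> with \<open>(y, t)\<close> or with
  \<open>(- y, - t)\<close>. The two inequalities \<open>neq\<close> then give strict
  convexity.\<close>

lemma chord_energy_combination_less:
  assumes cd: "c > 0" "d > 0" and xy: "\<bar>x\<bar> \<le> pi / 2" "\<bar>y\<bar> \<le> pi / 2"
    and ab: "\<bar>a\<bar> \<le> 1 / 2" "\<bar>b\<bar> \<le> 1 / 2"
    and M: "chord_energy c d x s \<le> M" "chord_energy c d y t \<le> M" "M > 0"
    and neq: "(x, s) \<noteq> (y, t)" "(x, s) \<noteq> (- y, - t)"
  shows "chord_energy c d (a * x + b * y) (a * s + b * t) < M"
proof (cases "\<bar>a\<bar> + \<bar>b\<bar> < 1")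
  case True
  have "chord_energy c d (a * x + b * y) (a * s + b * t) \<le>
      \<bar>a\<bar> * chord_energy c d x s + \<bar>b\<bar> * chord_energy c d y t"
    using True by (intro chord_energy_combination_le cd xy) simp
  also have "\<dots> \<le> \<bar>a\<bar> * M + \<bar>b\<bar> * M"
    using M by (intro add_mono mult_left_mono) auto
  also have "\<dots> = (\<bar>a\<bar> + \<bar>b\<bar>) * M"
    by (simp add: algebra_simps)
  also have "\<dots> < M"
    using True M(3) by simp
  finally show ?thesis .
next
  case False
  then have "\<bar>a\<bar> = 1 / 2" "\<bar>b\<bar> = 1 / 2" using ab by auto
  then have a: "a = 1 / 2 \<or> a = - 1 / 2" and b: "b = a \<or> b = - a"
    by (auto simp: abs_if split: if_splits)
  have plus: "chord_energy c d ((x + y) / 2) ((s + t) / 2) < M"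
    using chord_energy_midpoint_less[OF cd xy neq(1)] M by simp
  have minus: "chord_energy c d ((x - y) / 2) ((s - t) / 2) < M"
    using chord_energy_midpoint_less[of c d x "- y" s "- t"] cd xy neq M by simp
  have half: "chord_energy c d (1 / 2 * u) (1 / 2 * v) = chord_energy c d (u / 2) (v / 2)"
    "chord_energy c d (- 1 / 2 * u) (- 1 / 2 * v) = chord_energy c d (u / 2) (v / 2)" for u v
    using chord_energy_minus[of c d "u / 2" "v / 2"] by simp_all
  have "a * x + b * y = a * (x + y) \<and> a * s + b * t = a * (s + t) \<or>
      a * x + b * y = a * (x - y) \<and> a * s + b * t = a * (s - t)"
    using b by (auto simp: algebra_simps)
  then show ?thesis
    using a plus minus half by (elim disjE conjE) (simp_all only:)
qed

section \<open>Reduction modulo two integer vectors, and unimodularity of the nearest neighbor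
  pairs\<close>

lemma reduction_modulo_lattice:
  fixes k1 l1 k2 l2 n m :: int
  assumes "k1 * l2 - k2 * l1 \<noteq> 0"
  obtains s q n' m' :: int and a b :: real
  where "n = s * k1 + q * k2 + n'" "m = s * l1 + q * l2 + m'"
    "\<bar>a\<bar> \<le> 1 / 2" "\<bar>b\<bar> \<le> 1 / 2"
    "of_int n' = a * of_int k1 + b * of_int k2" "of_int m' = a * of_int l1 + b * of_int l2"
proof -
  define d where "d = real_of_int (k1 * l2 - k2 * l1)"
  have d: "d \<noteq> 0" using assms unfolding d_def by (simp only: of_int_eq_0_iff) simp
  \<comment> \<open>\<open>A\<close> and \<open>B\<close> are the real coordinates given by Cramer's
    rule; rounding them to nearest integers leaves coefficients of size at most 1/2.\<close>
  define A where "A = real_of_int (n * l2 - m * k2) / d"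
  define B where "B = real_of_int (m * k1 - n * l1) / d"
  have "d * (A * k1 + B * k2) = d * n" "d * (A * l1 + B * l2) = d * m"
    using d by (simp_all add: A_def B_def distrib_left) (simp_all add: d_def algebra_simps)
  then have AB: "A * k1 + B * k2 = n" "A * l1 + B * l2 = m"
    using d by simp_all
  show thesis
  proof
    show "n = round A * k1 + round B * k2 + (n - round A * k1 - round B * k2)"
      "m = round A * l1 + round B * l2 + (m - round A * l1 - round B * l2)"
      by simp_all
    show "\<bar>A - round A\<bar> \<le> 1 / 2" "\<bar>B - round B\<bar> \<le> 1 / 2"
      using of_int_round_abs_le[of A] of_int_round_abs_le[of B] by (simp_all add: abs_minus_commute)
    show "real_of_int (n - round A * k1 - round B * k2) = (A - round A) * k1 + (B - round B) * k2"
      "real_of_int (m - round A * l1 - round B * l2) = (A - round A) * l1 + (B - round B) * l2"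
      using AB by (simp_all add: algebra_simps)
  qed
qed

text \<open>Expressing both unit vectors gives an integer inverse matrix, so the determinant divides
  1.\<close>

lemma abs_det_eq_1_if_generating:
  fixes k1 l1 k2 l2 :: int
  assumes "\<And>n m. \<exists>s q. n = s * k1 + q * k2 \<and> m = s * l1 + q * l2"
  shows "\<bar>k1 * l2 - k2 * l1\<bar> = 1"
proof -
  obtain s q where 1: "1 = s * k1 + q * k2" "0 = s * l1 + q * l2"
    using assms by blast
  obtain s' q' where 2: "0 = s' * k1 + q' * k2" "1 = s' * l1 + q' * l2"
    using assms by blast
  have "(k1 * l2 - k2 * l1) * (s * q' - q * s') =
      (s * k1 + q * k2) * (s' * l1 + q' * l2) - (s * l1 + q * l2) * (s' * k1 + q' * k2)"
    by (simp add: algebra_simps)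
  also have "\<dots> = 1" using 1 2 by simp
  finally show ?thesis by (metis abs_zmult_eq_1 abs_one)
qed

text \<open>It suffices that the pairs generate all integer pairs, that is, that every reduced
  remainder \<open>(n', m')\<close> vanishes. A nonzero one would be a candidate strictly shorter
  than a minimizer.\<close>

lemma nearest_neighbors_unimodular:
  fixes e z p :: "real^3"
  assumes e: "norm e = 1" and \<tau>: "\<tau> \<noteq> 0" and i: "i \<ge> 1" and \<alpha>: "\<alpha> = 2 * pi / of_int i"
    and r: "r > 0" and p: "p \<noteq> z" "(p - z) \<bullet> e = 0"
    and min1: "is_arg_min (nn_dist2 r \<theta> \<tau> \<alpha>)
      (\<lambda>(n, m). (n, m) \<in> nn_candidates e \<theta> \<tau> i \<alpha> z r) (k1, l1)"
    and min2: "is_arg_min (nn_dist2 r \<theta> \<tau> \<alpha>)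
      (\<lambda>(n, m). (n, m) \<in> nn_candidates e \<theta> \<tau> i \<alpha> z r \<and> l1 * n \<noteq> m * k1) (k2, l2)"
    and angle1: "\<bar>of_int l1 * \<theta> + of_int k1 * \<alpha>\<bar> \<le> pi / 2"
    and angle2: "\<bar>of_int l2 * \<theta> + of_int k2 * \<alpha>\<bar> \<le> pi / 2"
  shows "\<bar>k1 * l2 - k2 * l1\<bar> = 1"
proof (rule abs_det_eq_1_if_generating)
  fix n m :: int
  define E where "E = chord_energy (2 * r\<^sup>2) (\<tau>\<^sup>2)"
  define x1 where "x1 = of_int l1 * \<theta> + of_int k1 * \<alpha>"
  define x2 where "x2 = of_int l2 * \<theta> + of_int k2 * \<alpha>"
  note dist = nn_dist2_eq_chord_energy[of r \<theta> \<tau> \<alpha>, folded E_def]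
  have cand1: "(k1, l1) \<in> nn_candidates e \<theta> \<tau> i \<alpha> z r"
    and le1: "\<And>n m. (n, m) \<in> nn_candidates e \<theta> \<tau> i \<alpha> z r \<Longrightarrow>
        E x1 l1 \<le> E (of_int m * \<theta> + of_int n * \<alpha>) m"
    using min1 by (fastforce simp: is_arg_min_def dist x1_def)+
  have cand2: "(k2, l2) \<in> nn_candidates e \<theta> \<tau> i \<alpha> z r" "l1 * k2 \<noteq> l2 * k1"
    and le2: "\<And>n m. (n, m) \<in> nn_candidates e \<theta> \<tau> i \<alpha> z r \<Longrightarrow> l1 * n \<noteq> m * k1 \<Longrightarrow>
        E x2 l2 \<le> E (of_int m * \<theta> + of_int n * \<alpha>) m"
    using min2 by (fastforce simp: is_arg_min_def dist x2_def)+
  have det: "k1 * l2 - k2 * l1 \<noteq> 0" using cand2(2) by (simp add: algebra_simps)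
  have \<alpha>0: "\<alpha> > 0" using \<alpha> i by simp
  have pos: "2 * r\<^sup>2 > 0" "\<tau>\<^sup>2 > 0" using r \<tau> by auto
  have x: "\<bar>x1\<bar> \<le> pi / 2" "\<bar>x2\<bar> \<le> pi / 2" using angle1 angle2 by (auto simp: x1_def x2_def)
  obtain s q n' m' and a b :: real where red: "n = s * k1 + q * k2 + n'" "m = s * l1 + q * l2 + m'"
    "\<bar>a\<bar> \<le> 1 / 2" "\<bar>b\<bar> \<le> 1 / 2"
    "of_int n' = a * of_int k1 + b * of_int k2" "of_int m' = a * of_int l1 + b * of_int l2"
    using reduction_modulo_lattice[OF det] by blast
  have "n' = 0 \<and> m' = 0"
  proof (rule ccontr)
    assume nz: "\<not> (n' = 0 \<and> m' = 0)"
    have angle: "of_int m' * \<theta> + of_int n' * \<alpha> = a * x1 + b * x2"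
      by (simp add: red x1_def x2_def algebra_simps)
    \<comment> \<open>Used with three values of \<open>c\<close>: \<open>pi / 2\<close> for the
      angle, \<open>i\<close> and \<open>nn_bound r \<tau>\<close> for the candidate bounds.\<close>
    have half: "\<bar>a * u + b * v\<bar> \<le> c" if "\<bar>u\<bar> \<le> c" "\<bar>v\<bar> \<le> c" for u v c :: real
    proof -
      have "\<bar>a * u + b * v\<bar> \<le> \<bar>a\<bar> * \<bar>u\<bar> + \<bar>b\<bar> * \<bar>v\<bar>"
        by (metis abs_mult abs_triangle_ineq)
      also have "\<dots> \<le> 1 / 2 * c + 1 / 2 * c"
        using that red by (intro add_mono mult_mono) auto
      finally show ?thesis by simp
    qed
    \<comment> \<open>A nonzero pair representing the identity turns by at least a full
      \<open>2 * pi\<close>, while the remainder has angle at most \<open>pi / 2\<close>.\<close>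
    have "helix_elem e \<theta> \<tau> \<alpha> z n' m' \<noteq> id"
    proof
      assume "helix_elem e \<theta> \<tau> \<alpha> z n' m' = id"
      then have m': "m' = 0" and "i dvd n'"
        using helix_elem_eq_id_iff[OF e \<tau> i \<alpha> p] by auto
      then have "\<bar>n'\<bar> \<ge> i" using nz i dvd_imp_le_int[of n' i] by auto
      then have "real_of_int i * \<alpha> \<le> \<bar>of_int n'\<bar> * \<alpha>"
        using \<alpha>0 by (intro mult_right_mono) linarith+
      also have "\<dots> = \<bar>of_int n' * \<alpha>\<bar>"
        using \<alpha>0 by (simp add: abs_mult)
      also have "\<dots> \<le> pi / 2"
        using half[OF x] angle m' by simp
      finally have "real_of_int i * \<alpha> \<le> pi / 2" .
      then show False using i \<alpha> by simp
    qed
    moreover have "\<bar>real_of_int n'\<bar> \<le> of_int i"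
      unfolding red by (rule half) (use cand1 cand2 in \<open>auto simp: nn_candidates_def\<close>)
    moreover have "\<bar>real_of_int m'\<bar> \<le> of_int (nn_bound r \<tau>)"
      unfolding red by (rule half) (use cand1 cand2 in \<open>auto simp: nn_candidates_def\<close>)
    ultimately have cand: "(n', m') \<in> nn_candidates e \<theta> \<tau> i \<alpha> z r"
      by (auto simp: nn_candidates_def)
    have x0: "x1 \<noteq> 0 \<or> real_of_int l1 \<noteq> 0" "x2 \<noteq> 0 \<or> real_of_int l2 \<noteq> 0"
      using det \<alpha>0 by (auto simp: x1_def x2_def)
    have E1: "E x1 l1 > 0" and E2: "E x2 l2 > 0"
      using chord_energy_pos[OF pos] x x0 by (simp_all add: E_def)
    show False
    proof (cases "l1 * n' = m' * k1")
      \<comment> \<open>A remainder parallel to \<open>(k1, l1)\<close> has \<open>b = 0\<close>, so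
        it is at most half as costly as the first minimizer.\<close>
      case True
      then have "of_int l1 * real_of_int n' = of_int m' * of_int k1"
        by (metis of_int_mult)
      then have "b * of_int (k1 * l2 - k2 * l1) = 0"
        by (auto simp: red algebra_simps)
      then have b: "b = 0" using det by (simp only: mult_eq_0_iff of_int_eq_0_iff) simp
      have "E (a * x1 + b * x2) m' \<le> \<bar>a\<bar> * E x1 l1 + \<bar>b\<bar> * E x2 l2"
        unfolding E_def red by (rule chord_energy_combination_le[OF pos x]) (use red in simp)
      also have "\<dots> \<le> 1 / 2 * E x1 l1"
        using E1 red b by simp
      also have "\<dots> < E x1 l1" using E1 by simp
      finally show False using le1[OF cand] angle by simp
    next
      \<comment> \<open>A remainder not parallel to \<open>(k1, l1)\<close> competes with the second
        minimizer, whose value dominates that of the first and hence serves as the common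
        bound.\<close>
      case False
      have "E (a * x1 + b * x2) m' < E x2 l2"
        unfolding E_def red
      proof (rule chord_energy_combination_less[OF pos x red(3,4)])
        show "chord_energy (2 * r\<^sup>2) (\<tau>\<^sup>2) x1 l1 \<le> chord_energy (2 * r\<^sup>2) (\<tau>\<^sup>2) x2 l2"
          using le1[OF cand2(1)] by (simp add: E_def x2_def)
        show "chord_energy (2 * r\<^sup>2) (\<tau>\<^sup>2) x2 l2 > 0" using E2 by (simp add: E_def)
        show "(x1, real_of_int l1) \<noteq> (x2, real_of_int l2)"
          using det \<alpha>0 by (auto simp: x1_def x2_def)
        show "(x1, real_of_int l1) \<noteq> (- x2, - real_of_int l2)"
        proof
          assume "(x1, real_of_int l1) = (- x2, - real_of_int l2)"
          then have l: "real_of_int l1 = - real_of_int l2" and "x1 = - x2" by auto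
          then have "\<alpha> * (of_int k1 + of_int k2) = 0"
            by (simp add: x1_def x2_def algebra_simps)
          then have "real_of_int k1 = - of_int k2" using \<alpha>0 by simp
          then have "k1 = - k2" "l1 = - l2" using l by linarith+
          then show False using det by simp
        qed
      qed simp
      then show False using le2[OF cand False] angle by simp
    qed
  qed
  then show "\<exists>s q. n = s * k1 + q * k2 \<and> m = s * l1 + q * l2"
    using red by auto
qed

section \<open>The number of second exponents and the parametrization of the group\<close>

text \<open>Division by a determinant 1 or -1 only affects the sign, so the values of
  \<open>qhat\<close> at nonzero \<open>n\<close> are the nonzero multiples of
  \<open>i * m1\<close>.\<close>

lemma qstar_unimodular:
  assumes "\<bar>n1 * m2 - n2 * m1\<bar> = 1" "i \<ge> 1" "m1 \<noteq> 0"
  shows "qstar i (n1, m1) (n2, m2) = i * \<bar>m1\<bar>"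
proof -
  define d where "d = n1 * m2 - n2 * m1"
  have d: "d = 1 \<or> d = - 1" using assms(1) unfolding d_def by linarith
  have qhat: "qhat i (n1, m1) (n2, m2) n = of_int (- d * n * i * m1)" for n
  proof -
    have "qhat i (n1, m1) (n2, m2) n = of_int (- n * i * m1) / of_int d"
      by (simp only: qhat_def d_def prod.case)
    then show ?thesis using d by auto
  qed
  show ?thesis
    unfolding qstar_def
  proof (rule Least_equality)
    \<comment> \<open>This sign cancels both that of the determinant and that of
      \<open>m1\<close>.\<close>
    let ?n = "- d * sgn m1"
    have "of_int (i * \<bar>m1\<bar>) = qhat i (n1, m1) (n2, m2) ?n"
      using d by (auto simp: qhat abs_sgn)
    moreover have "?n \<noteq> 0" using assms d by (auto simp: sgn_eq_0_iff)
    moreover have "real_of_int (i * \<bar>m1\<bar>) > 0"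
      using assms by simp
    ultimately show "real_of_int (i * \<bar>m1\<bar>) \<in> {qhat i (n1, m1) (n2, m2) n |n.
        n \<noteq> 0 \<and> 0 < qhat i (n1, m1) (n2, m2) n \<and> qhat i (n1, m1) (n2, m2) n \<in> \<int>}"
      by (smt (verit) Ints_of_int mem_Collect_eq)
  next
    fix q :: int
    assume "real_of_int q \<in> {qhat i (n1, m1) (n2, m2) n |n.
        n \<noteq> 0 \<and> 0 < qhat i (n1, m1) (n2, m2) n \<and> qhat i (n1, m1) (n2, m2) n \<in> \<int>}"
    then obtain n where "real_of_int q = of_int (- d * n * i * m1)"
      "n \<noteq> 0" "(0::real) < of_int (- d * n * i * m1)"
      unfolding qhat by blast
    then have "q = - d * n * i * m1" "q > 0"
      by (simp_all only: of_int_eq_iff of_int_0_less_iff)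
    moreover have "i * \<bar>m1\<bar> dvd - d * n * i * m1"
      by simp
    ultimately show "i * \<bar>m1\<bar> \<le> q"
      by (metis zdvd_imp_le)
  qed
qed

theorem mainTheorem4:
  fixes e z p :: "real^3" and \<theta> \<tau> \<alpha> r :: real and i n1 m1 n2 m2 :: int
    and g :: "int \<Rightarrow> int \<Rightarrow> real^3 \<Rightarrow> real^3"
  assumes "norm e = 1"
    and "\<tau> \<noteq> 0"
    and "i \<ge> 1"
    and "\<alpha> = 2 * pi / of_int i"
    and "r = norm (p - z)"
    and "r > 0"
    and "(p - z) \<bullet> e = 0"
    and "g = helix_elem e \<theta> \<tau> \<alpha> z"
    and "nearest_neighbor_pairs e \<theta> \<tau> i \<alpha> z r (n1, m1) (n2, m2)"
    and "- pi / 2 \<le> of_int m1 * \<theta> + of_int n1 * \<alpha>" "of_int m1 * \<theta> + of_int n1 * \<alpha> \<le> pi / 2"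
    and "- pi / 2 \<le> of_int m2 * \<theta> + of_int n2 * \<alpha>" "of_int m2 * \<theta> + of_int n2 * \<alpha> \<le> pi / 2"
  shows "\<forall>q0::int.
    let D = (UNIV :: int set) \<times> {q0 + 1 .. q0 + qstar i (n1, m1) (n2, m2)};
        w = (\<lambda>(s::int, q::int).
               g n1 m1 [^]\<^bsub>isometry_group\<^esub> s \<otimes>\<^bsub>isometry_group\<^esub> g n2 m2 [^]\<^bsub>isometry_group\<^esub> q)
    in helix_group e \<theta> \<tau> i \<alpha> z = w ` D \<and> inj_on w D"
proof -
  have pz: "p \<noteq> z" using assms by auto
  have angles: "\<bar>of_int m1 * \<theta> + of_int n1 * \<alpha>\<bar> \<le> pi / 2" "\<bar>of_int m2 * \<theta> + of_int n2 * \<alpha>\<bar> \<le> pi / 2"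
    using assms(10-13) by (intro abs_leI; linarith)+
  note uni = nearest_neighbors_unimodular[OF assms(1,2,3,4,6) pz assms(7)]
  have m1: "m1 \<noteq> 0"
    using assms(9) by (auto simp: nearest_neighbor_pairs_def)
  define d where "d = n1 * m2 - n2 * m1"
  \<comment> \<open>The two alternatives correspond to the two possible orders of the
    minimizers.\<close>
  have "\<bar>n1 * m2 - n2 * m1\<bar> = 1 \<or> \<bar>n2 * m1 - n1 * m2\<bar> = 1"
    using assms(9) uni angles unfolding nearest_neighbor_pairs_def by auto
  then have det: "\<bar>n1 * m2 - n2 * m1\<bar> = 1" by linarith
  then have dd: "d * d = 1" unfolding d_def by (metis abs_mult_self_eq mult_1)
  define Q where "Q = i * \<bar>m1\<bar>"
  have Q: "qstar i (n1, m1) (n2, m2) = Q" "Q > 0"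
    using qstar_unimodular[OF det assms(3) m1] m1 assms(3) by (auto simp: Q_def)
  note add = helix_elem_add[OF assms(1), of \<theta> \<tau> \<alpha> z, folded assms(8), symmetric]
  note id_iff = helix_elem_eq_id_iff[OF assms(1-4) pz assms(7), of \<theta>, folded assms(8)]
  have g_eq_iff: "g n m = g n' m' \<longleftrightarrow> m = m' \<and> i dvd n - n'" for n m n' m'
  proof
    assume eq: "g n m = g n' m'"
    have "g (n - n') (m - m') = g n m \<circ> g (- n') (- m')" by (simp add: add)
    also have "\<dots> = id" unfolding eq by (simp add: add id_iff)
    finally show "m = m' \<and> i dvd n - n'" by (simp add: id_iff)
  next
    assume *: "m = m' \<and> i dvd n - n'"
    have "g n m = g n' m' \<circ> g (n - n') 0" using * by (simp add: add)
    also have "g (n - n') 0 = id" using * by (simp add: id_iff)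
    finally show "g n m = g n' m'" by simp
  qed
  have word: "g n1 m1 [^]\<^bsub>isometry_group\<^esub> s \<otimes>\<^bsub>isometry_group\<^esub> g n2 m2 [^]\<^bsub>isometry_group\<^esub> q =
      g (s * n1 + q * n2) (s * m1 + q * m2)" for s q :: int
    unfolding assms(8) helix_elem_int_pow[OF assms(1)] helix_elem_add[OF assms(1)]
    by (simp add: isometry_group_def)
  \<comment> \<open>The bound on \<open>n\<close> loses nothing, since \<open>n mod i\<close>
    represents the same element.\<close>
  have group_eq: "helix_group e \<theta> \<tau> i \<alpha> z = {g n m |n m. True}"
  proof -
    have "\<exists>n'\<in>{-i..i}. g n m = g n' m" for n m
      by (rule bexI[of _ "n mod i"])
        (use assms(3) pos_mod_bound[of i n] pos_mod_sign[of i n] in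
          \<open>auto simp: g_eq_iff minus_mod_eq_mult_div simp del: pos_mod_bound pos_mod_sign\<close>)
    then show ?thesis
      unfolding helix_group_def assms(8)[symmetric] by blast
  qed
  have surj: "\<exists>s. \<exists>q\<in>{q0 + 1..q0 + Q}. g n m = g (s * n1 + q * n2) (s * m1 + q * m2)"
    for q0 n m :: int
  proof -
    \<comment> \<open>Cramer's rule, with \<open>d\<close> as its own inverse.\<close>
    define s where "s = d * (n * m2 - m * n2)"
    define q where "q = d * (m * n1 - n * m1)"
    \<comment> \<open>Adding \<open>j * i * (m2, - m1)\<close> to the exponents changes
      \<open>(n, m)\<close> by \<open>(j * i * d, 0)\<close>, which lies in the kernel. The quotient
      brings the second exponent into the window starting at \<open>q0 + 1\<close>;
      \<open>sgn m1\<close> converts steps of \<open>i * m1\<close> into steps of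
      \<open>Q\<close>.\<close>
    define j where "j = (q - q0 - 1) div Q * sgn m1"
    have "s * n1 + q * n2 = d * d * n" "s * m1 + q * m2 = d * d * m"
      by (simp_all add: s_def q_def d_def algebra_simps)
    then have nm: "s * n1 + q * n2 = n" "s * m1 + q * m2 = m"
      by (simp_all add: dd)
    let ?s = "s + j * i * m2" and ?q = "q - j * i * m1"
    have "j * i * m1 = (q - q0 - 1) div Q * Q"
      by (simp add: j_def Q_def abs_sgn)
    then have "?q = q0 + 1 + (q - q0 - 1) mod Q"
      using minus_div_mult_eq_mod[of "q - q0 - 1" Q] by simp
    then have "?q \<in> {q0 + 1..q0 + Q}"
      using pos_mod_bound[OF Q(2), of "q - q0 - 1"] pos_mod_sign[OF Q(2), of "q - q0 - 1"]
      by (simp del: pos_mod_bound pos_mod_sign)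
    moreover have "?s * m1 + ?q * m2 = m"
      using nm(2) by (simp add: algebra_simps)
    moreover have "n - (?s * n1 + ?q * n2) = i * (- j * d)"
      using nm(1) by (simp add: d_def algebra_simps)
    then have "i dvd n - (?s * n1 + ?q * n2)" by (metis dvd_triv_left)
    ultimately show ?thesis
      by (metis g_eq_iff)
  qed
  have inj: "s = s' \<and> q = q'"
    if eq: "g (s * n1 + q * n2) (s * m1 + q * m2) = g (s' * n1 + q' * n2) (s' * m1 + q' * m2)"
      and q: "q \<in> {q0 + 1..q0 + Q}" "q' \<in> {q0 + 1..q0 + Q}" for q0 s q s' q' :: int
  proof -
    have 1: "(s - s') * m1 + (q - q') * m2 = 0"
      and "i dvd (s - s') * n1 + (q - q') * n2"
      using eq by (simp_all add: g_eq_iff algebra_simps)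
    then obtain k where 2: "(s - s') * n1 + (q - q') * n2 = i * k" by blast
    \<comment> \<open>This combination eliminates \<open>s - s'\<close> and shows that
      \<open>q - q'\<close> is a multiple of \<open>Q\<close>; the window has length
      \<open>Q\<close>, so the difference is 0. Then \<open>m1 \<noteq> 0\<close> settles
      \<open>s\<close>.\<close>
    have "(q - q') * d =
        n1 * ((s - s') * m1 + (q - q') * m2) - m1 * ((s - s') * n1 + (q - q') * n2)"
      by (simp add: d_def algebra_simps)
    then have "(q - q') * d = - m1 * i * k" unfolding 1 2 by simp
    then have "(q - q') * (d * d) = - m1 * i * k * d" by (metis mult.assoc)
    then have "q - q' = i * m1 * (- k * d)" by (simp add: dd)
    then have "i * m1 dvd q - q'" by (metis dvd_triv_left)
    then have "Q dvd q - q'" by (cases "m1 > 0") (simp_all add: Q_def)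
    moreover have "\<bar>q - q'\<bar> < Q" using q by auto
    ultimately have "q = q'"
      using dvd_imp_le_int[of "q - q'" Q] Q(2) by (cases "q = q'") auto
    with 1 m1 show ?thesis by simp
  qed
  show ?thesis
    unfolding Let_def Q(1) word group_eq
    using surj inj by (fastforce simp: inj_on_def image_iff)
qed

end
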